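(* Let $\{P_n(z)\}_{n=0}^\infty$ be the family of monic polynomials ($\deg P_n=n$) orthogonal with respect to the weight $w(z)\,d_qz$, i.e. $\int_{-\infty}^{\infty}P_n(x)P_m(x)w(x)\,d_qx=\gamma_n\delta_{n,m}$, and let $\alpha_n=\gamma_n/\gamma_{n-1}$. Then there are constants $A$ and $B$ such that, as $n\to\infty$ through even $n\in\mathbb{N}$, \[ \gamma_n=q^{\frac n2(1-n)}\left(A+O(q^{n/2})\right),\qquad \gamma_{n-1}=q^{\frac n2(3-n)}\left(B^{-1}+O(q^{n/2})\right),\qquad \alpha_n=q^{-n}\left(q+O(q^{n/2})\right). \]
   Context: $q\in\mathbb{R}$, $0<q<1$; $(x;q)_\infty=\prod_{j\ge0}(1-xq^j)$; $w(x)=1/(-x^4;q^4)_\infty$; $\int_{-\infty}^{\infty}f(x)\,d_qx=\sum_{k\in\mathbb{Z}}q^k\big(f(q^k)+f(-q^k)\big)$. The numbers $\alpha_n$ are the coefficients in the recurrence $xP_n(x)=P_{n+1}(x)+\alpha_nP_{n-1}(x)$. *)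

theory Defs
  imports
    "HOL-Analysis.Analysis"
    "HOL-Computational_Algebra.Polynomial"
    "HOL-Library.Landau_Symbols"
begin

definition qpochhammer_inf :: "real \<Rightarrow> real \<Rightarrow> real" where
  "qpochhammer_inf x q = (\<Prod>j. 1 - x * q ^ j)"

definition weight :: "real \<Rightarrow> real \<Rightarrow> real" where
  "weight q x = 1 / qpochhammer_inf (- (x ^ 4)) (q ^ 4)"

text \<open>
  The Jackson integral over the whole real line. The bilateral sum is an unordered
  (hence absolutely convergent) one, with value 0 for divergent sums; for a polynomial times
  \<open>weight q\<close> with \<open>0 < q < 1\<close> it always converges.
\<close>

definition jackson_integral :: "real \<Rightarrow> (real \<Rightarrow> real) \<Rightarrow> real" where
  "jackson_integral q f = (\<Sum>\<^sub>\<infinity>k\<in>(UNIV :: int set). q powi k * (f (q powi k) + f (- (q powi k))))"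

definition monic_orthogonal_family :: "real \<Rightarrow> (nat \<Rightarrow> real poly) \<Rightarrow> (nat \<Rightarrow> real) \<Rightarrow> bool" where
  "monic_orthogonal_family q P \<gamma> \<longleftrightarrow>
     (\<forall>n. degree (P n) = n \<and> lead_coeff (P n) = 1) \<and>
     (\<forall>n m. jackson_integral q (\<lambda>x. poly (P n) x * poly (P m) x * weight q x)
              = (if n = m then \<gamma> n else 0))"

text \<open>The filter ``\<open>n \<rightarrow> \<infinity>\<close> through even \<open>n\<close>''.\<close>

definition at_top_even :: "nat filter" where
  "at_top_even = inf at_top (principal {n. even n})"

end

theory Submission
  imports Defs
begin

text \<open>
  Write \<open>n = 2 m + d\<close> with \<open>d \<in> {0, 1}\<close> and \<open>Q = q\<^sup>4\<close>. On the lattice \<open>\<plusminus>q\<^sup>k\<close> the weight factors as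
  \[ w(q^k) = C\, q^{2k(k-1)}\, (-Q q^{-4k}; Q)_\infty, \]
  a Gaussian in \<open>k\<close> times a factor that tends to \<open>1\<close> as \<open>k \<rightarrow> -\<infinity>\<close>; and the mass of
  \<open>P\<^sub>n\<^sup>2 w\<close> sits near \<open>k = - n / 2\<close>. So the norms should be those of the Gaussian weight, for which
  everything is explicit: its even moments are \<open>2 c q\<^bsup>-j(j-1)/2\<^esup>\<close> and its odd ones vanish, so that its
  orthogonal polynomials are \<open>x\<^sup>d s(x\<^sup>2)\<close> with \<open>s\<close> of Stieltjes--Wigert type, and the \<open>q\<close>-binomial
  theorem gives the norm \<open>2 c q\<^bsup>-m\<^esup> (q; q)\<^sub>m\<close> for the non-monic version \<open>T\<close> used below. The finite
  product \<open>(q; q)\<^sub>m\<close> differs from \<open>(q; q)\<^sub>\<infinity>\<close> by \<open>O(q\<^sup>m)\<close>, which is the claimed error.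

  The comparison uses only that \<open>\<gamma>\<^sub>n\<close> is the least norm of a monic polynomial of degree \<open>n\<close>. Let \<open>J\<close> be the
  functional of the Gaussian weight. From below, the last factor is at least \<open>1\<close>, so the least norm for
  \<open>w\<close> is at least \<open>C\<close> times the one for \<open>J\<close>. From above, \<open>T\<close> serves as a test polynomial:
  by the \<open>q\<close>-binomial theorem the last factor is at most
  \<open>1 + K \<Sum>\<^bsub>r \<ge> 1\<^esub> Q\<^bsup>r(r+1)/2\<^esup> x\<^bsup>-4r\<^esup>\<close> at \<open>x = q\<^sup>k\<close>, and multiplying a Gaussian by \<open>x\<^bsup>-4r\<^esup>\<close> amounts
  to shifting \<open>k\<close> by \<open>r\<close>, so the error is at most \<open>K \<Sum>\<^bsub>r \<ge> 1\<^esub> q\<^sup>r J[T(q\<^sup>r x)\<^sup>2]\<close>. Each of these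
  values of \<open>J\<close> is bounded uniformly in \<open>m\<close> and \<open>r\<close> (\<open>sw_poly_scaled_norm\<close>), whereas
  \<open>J[T\<^sup>2]\<close> is of order \<open>q\<^bsup>-m\<^esup>\<close>: the relative error is again \<open>O(q\<^sup>m)\<close>.

  Both parities of \<open>n\<close> thus have the same constant \<open>A = 2 c C (q; q)\<^sub>\<infinity>\<close> up to an explicit power of \<open>q\<close>,
  which yields \<open>B = q / A\<close> and, on division, the limit \<open>q\<close> for \<open>q\<^sup>n \<alpha>\<^sub>n\<close>.
\<close>

section \<open>Finite and infinite \<open>q\<close>-products\<close>

definition qpochhammer :: "real \<Rightarrow> real \<Rightarrow> nat \<Rightarrow> real" where
  "qpochhammer x b n = (\<Prod>j<n. 1 - x * b ^ j)"

lemma qpochhammer_tendsto: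
  assumes "0 < b" "b < 1"
  shows "qpochhammer x b \<longlonglongrightarrow> qpochhammer_inf x b"
    and "(\<And>j. x * b ^ j \<noteq> 1) \<Longrightarrow> qpochhammer_inf x b \<noteq> 0"
proof -
  have "summable (\<lambda>j. norm ((1 - x * b ^ j) - 1))"
    using assms by (simp add: abs_mult power_abs summable_mult summable_geometric)
  then have conv: "convergent_prod (\<lambda>j. 1 - x * b ^ j)"
    by (intro abs_convergent_prod_imp_convergent_prod) (simp only: abs_convergent_prod_conv_summable)
  from convergent_prod_LIMSEQ[OF this] show "qpochhammer x b \<longlonglongrightarrow> qpochhammer_inf x b"
    unfolding qpochhammer_inf_def qpochhammer_def [abs_def]
    by (simp only: LIMSEQ_lessThan_iff_atMost)
  assume "\<And>j. x * b ^ j \<noteq> 1"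
  then show "qpochhammer_inf x b \<noteq> 0"
    unfolding qpochhammer_inf_def by (intro prodinf_nonzero conv) (metis eq_iff_diff_eq_0)
qed

lemma qpochhammer_eq_0: "j < m \<Longrightarrow> x * q ^ j = 1 \<Longrightarrow> qpochhammer x q m = 0"
  unfolding qpochhammer_def by (intro prod_zero bexI[of _ j]) auto

lemma qpochhammer_Suc_shift: "qpochhammer x b (Suc n) = (1 - x) * qpochhammer (x * b) b n"
  by (simp add: qpochhammer_def prod.lessThan_Suc_shift mult.assoc del: prod.lessThan_Suc)

lemma qpochhammer_inf_shift:
  assumes "0 < b" "b < 1"
  shows "qpochhammer_inf x b = (1 - x) * qpochhammer_inf (x * b) b"
proof (rule LIMSEQ_unique)
  show "(\<lambda>n. qpochhammer x b (Suc n)) \<longlonglongrightarrow> qpochhammer_inf x b"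
    by (intro LIMSEQ_Suc qpochhammer_tendsto assms)
  show "(\<lambda>n. qpochhammer x b (Suc n)) \<longlonglongrightarrow> (1 - x) * qpochhammer_inf (x * b) b"
    unfolding qpochhammer_Suc_shift by (intro tendsto_intros qpochhammer_tendsto assms)
qed

lemma qpochhammer_inf_mono_neg:
  assumes "0 < b" "b < 1" "0 \<le> z" "z \<le> z'"
  shows "1 \<le> qpochhammer_inf (- z) b" "qpochhammer_inf (- z) b \<le> qpochhammer_inf (- z') b"
proof -
  have "1 \<le> qpochhammer (- z) b n" for n
    unfolding qpochhammer_def using assms by (intro prod_ge_1) simp
  then show "1 \<le> qpochhammer_inf (- z) b"
    by (intro LIMSEQ_le_const[OF qpochhammer_tendsto(1)[OF assms(1,2)]]) auto
  have "qpochhammer (- z) b n \<le> qpochhammer (- z') b n" for n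
    unfolding qpochhammer_def using assms
    by (intro prod_mono) (auto intro!: add_nonneg_nonneg mult_right_mono)
  then show "qpochhammer_inf (- z) b \<le> qpochhammer_inf (- z') b"
    by (intro LIMSEQ_le[OF qpochhammer_tendsto(1) qpochhammer_tendsto(1)] assms) auto
qed

context
  fixes q :: real
  assumes q: "0 < q" "q < 1"
begin

lemma qpochhammer_inf_ge_partial:
  assumes "0 \<le> z"
  shows "qpochhammer (- z) q n \<le> qpochhammer_inf (- z) q"
proof (rule incseq_le)
  show "incseq (qpochhammer (- z) q)"
  proof (rule incseq_SucI)
    fix n
    have "0 \<le> qpochhammer (- z) q n"
      unfolding qpochhammer_def using assms q by (intro prod_nonneg) auto
    then show "qpochhammer (- z) q n \<le> qpochhammer (- z) q (Suc n)"
      using assms q by (simp add: qpochhammer_def mult_left_mono algebra_simps)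
  qed
  show "qpochhammer (- z) q \<longlonglongrightarrow> qpochhammer_inf (- z) q"
    by (rule qpochhammer_tendsto[OF q])
qed

lemma qpochhammer_pos: "0 < qpochhammer q q n" "qpochhammer q q n \<le> 1"
proof -
  have "0 < 1 - q * q ^ j" "1 - q * q ^ j \<le> 1" for j
    using q power_Suc_less_one[of q j] by auto
  then show "0 < qpochhammer q q n" "qpochhammer q q n \<le> 1"
    unfolding qpochhammer_def by (auto intro!: prod_pos prod_le_1 simp: less_imp_le)
qed

lemma qpochhammer_inf_rate:
  shows "0 < qpochhammer_inf q q" "qpochhammer_inf q q \<le> qpochhammer q q m"
    "qpochhammer q q m \<le> qpochhammer_inf q q + q ^ Suc m / (1 - q)"
proof -
  note lim = qpochhammer_tendsto[OF q, where x = q]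
  have step: "qpochhammer q q (Suc n) = qpochhammer q q n - q ^ Suc n * qpochhammer q q n" for n
    by (simp add: qpochhammer_def algebra_simps)
  have nn: "0 \<le> q ^ Suc n * qpochhammer q q n" "q ^ Suc n * qpochhammer q q n \<le> q ^ Suc n" for n
    using q qpochhammer_pos[of n] by (auto intro!: mult_nonneg_nonneg mult_left_le simp: less_imp_le simp del: power_Suc)
  have "decseq (qpochhammer q q)"
    using nn(1) by (intro decseq_SucI) (simp add: step del: power_Suc)
  then show le: "qpochhammer_inf q q \<le> qpochhammer q q m" for m
    using decseq_ge[OF _ lim(1)] by blast
  \<comment> \<open>The geometric tail dominates the sum of all remaining decrements, so subtracting it reverses the monotonicity.\<close>
  have "incseq (\<lambda>n. qpochhammer q q n - q ^ Suc n / (1 - q))"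
  proof (rule incseq_SucI)
    fix n
    have "q ^ Suc n / (1 - q) - q ^ Suc (Suc n) / (1 - q) = q ^ Suc n"
      using q by (simp add: diff_divide_distrib [symmetric] divide_eq_eq algebra_simps)
    then show "qpochhammer q q n - q ^ Suc n / (1 - q) \<le> qpochhammer q q (Suc n) - q ^ Suc (Suc n) / (1 - q)"
      using nn(2)[of n] step[of n] by linarith
  qed
  moreover have "(\<lambda>n. qpochhammer q q n - q ^ Suc n / (1 - q)) \<longlonglongrightarrow> qpochhammer_inf q q - 0 / (1 - q)"
    using q by (intro tendsto_intros lim(1) LIMSEQ_Suc[where f = "\<lambda>n. q ^ n"] LIMSEQ_power_zero) auto
  ultimately have "qpochhammer q q m - q ^ Suc m / (1 - q) \<le> qpochhammer_inf q q - 0 / (1 - q)"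
    by (rule incseq_le)
  then show "qpochhammer q q m \<le> qpochhammer_inf q q + q ^ Suc m / (1 - q)" by simp
  have "0 \<le> qpochhammer_inf q q"
    by (intro LIMSEQ_le_const[OF lim(1)]) (auto intro: less_imp_le[OF qpochhammer_pos(1)])
  moreover have "q * q ^ j \<noteq> 1" for j
    using q power_Suc_less_one[of q j] by auto
  ultimately show "0 < qpochhammer_inf q q"
    using lim(2) by force
qed

end

section \<open>The \<open>q\<close>-binomial theorem\<close>

fun qbinomial :: "real \<Rightarrow> nat \<Rightarrow> nat \<Rightarrow> real" where
  "qbinomial q m 0 = 1"
| "qbinomial q 0 (Suc k) = 0"
| "qbinomial q (Suc m) (Suc k) = q ^ Suc k * qbinomial q m (Suc k) + qbinomial q m k"

lemma qbinomial_eq_0: "m < k \<Longrightarrow> qbinomial q m k = 0"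
  by (induction q m k rule: qbinomial.induct) auto

lemma qbinomial_self: "qbinomial q m m = 1"
  by (induction m) (simp_all add: qbinomial_eq_0)

lemma qbinomial_nonneg: "0 \<le> q \<Longrightarrow> 0 \<le> qbinomial q m k"
  by (induction q m k rule: qbinomial.induct) auto

text \<open>
  The Pascal recurrence, after multiplication by \<open>(q; q)\<^bsub>k+1\<^esub>\<close>, is a convex combination with weights \<open>q\<^bsup>k+1\<^esup>\<close> and
  \<open>1 - q\<^bsup>k+1\<^esup>\<close> of the two previous instances. The bound serves because it is uniform in \<open>m\<close>.
\<close>
lemma qbinomial_le:
  assumes q: "0 < q" "q < 1"
  shows "qbinomial q m k * qpochhammer q q k \<le> 1"
  using q
proof (induction q m k rule: qbinomial.induct)
  case (3 q m k)
  have e: "qpochhammer q q (Suc k) = qpochhammer q q k * (1 - q ^ Suc k)"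
    by (simp add: qpochhammer_def)
  have "q ^ Suc k < 1" using 3 power_Suc_less_one by blast
  then have le: "q ^ Suc k * (qbinomial q m (Suc k) * qpochhammer q q (Suc k))
      + (1 - q ^ Suc k) * (qbinomial q m k * qpochhammer q q k)
     \<le> q ^ Suc k * 1 + (1 - q ^ Suc k) * 1"
    using 3 by (intro add_mono mult_left_mono) auto
  have "qbinomial q (Suc m) (Suc k) * qpochhammer q q (Suc k) =
      q ^ Suc k * (qbinomial q m (Suc k) * qpochhammer q q (Suc k))
      + (1 - q ^ Suc k) * (qbinomial q m k * qpochhammer q q k)"
    unfolding qbinomial.simps e by (simp add: algebra_simps del: power_Suc)
  also note le
  finally show ?case by simp
qed (simp_all add: qpochhammer_def)

lemma Suc_choose_2: "Suc k choose 2 = (k choose 2) + k"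
  by (simp add: numeral_2_eq_2)

lemma add_choose_2: "(a + b) choose 2 = (a choose 2) + (b choose 2) + a * b"
  by (induction b) (simp_all add: Suc_choose_2)

lemma q_binomial_theorem:
  "(\<Prod>j<m. 1 + z * q ^ j) = (\<Sum>k\<le>m. qbinomial q m k * q ^ (k choose 2) * z ^ k)"
proof (induction m arbitrary: z)
  case (Suc m)
  \<comment> \<open>Splitting off the factor at \<open>j = 0\<close> rather than the last one replaces \<open>z\<close> by \<open>z q\<close>, which matches the Pascal recurrence.\<close>
  define F where "F k = qbinomial q m k * q ^ (k choose 2) * (z * q) ^ k" for k
  have "(\<Sum>k\<le>Suc m. qbinomial q (Suc m) k * q ^ (k choose 2) * z ^ k)
      = 1 + (\<Sum>k\<le>m. F (Suc k) + z * F k)"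
    by (subst sum.atMost_Suc_shift)
      (simp add: F_def Suc_choose_2 algebra_simps power_add power_mult_distrib binomial_eq_0)
  also have "\<dots> = (\<Sum>k\<le>Suc m. F k) + z * (\<Sum>k\<le>m. F k)"
    by (subst sum.atMost_Suc_shift) (simp add: F_def sum.distrib sum_distrib_left numeral_2_eq_2)
  also have "\<dots> = (1 + z) * (\<Sum>k\<le>m. F k)"
    by (simp add: F_def qbinomial_eq_0 algebra_simps)
  also have "\<dots> = (\<Prod>j<Suc m. 1 + z * q ^ j)"
    unfolding F_def Suc.IH[symmetric]
    by (simp add: prod.lessThan_Suc_shift mult.assoc del: prod.lessThan_Suc)
  finally show ?case ..
qed (simp add: binomial_eq_0)

lemma qpochhammer_expand:
  "qpochhammer z q m = (\<Sum>k\<le>m. (-1) ^ k * qbinomial q m k * q ^ (k choose 2) * z ^ k)"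
  using q_binomial_theorem[of "- z" q m]
  by (simp add: qpochhammer_def power_minus[of z] mult_ac)

section \<open>Positive functionals carried by the lattice \<open>\<plusminus>q\<^sup>k\<close>\<close>

definition lattice_sum :: "real \<Rightarrow> (int \<Rightarrow> real) \<Rightarrow> real poly \<Rightarrow> real" where
  "lattice_sum q v p =
     (\<Sum>\<^sub>\<infinity>k\<in>UNIV. q powi k * v k * (poly p (q powi k) + poly p (- (q powi k))))"

text \<open>
  All moments are finite. The factor \<open>q powi k\<close> is the one of the Jackson integral and is kept apart
  from the weight.
\<close>
definition lattice_weight :: "real \<Rightarrow> (int \<Rightarrow> real) \<Rightarrow> bool" where
  "lattice_weight q v \<longleftrightarrow>
     0 < q \<and> (\<forall>k. 0 \<le> v k) \<and> (\<forall>s::nat. (\<lambda>k. q powi k * v k * (q powi k) ^ s) summable_on UNIV)"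

text \<open>
  Polynomials of degree below \<open>n\<close> are described by vanishing coefficients, so that for \<open>n = 0\<close> only the
  zero polynomial is meant.
\<close>
definition orthogonal_below :: "real \<Rightarrow> (int \<Rightarrow> real) \<Rightarrow> real poly \<Rightarrow> nat \<Rightarrow> bool" where
  "orthogonal_below q v T n \<longleftrightarrow> (\<forall>D. (\<forall>i\<ge>n. coeff D i = 0) \<longrightarrow> lattice_sum q v (T * D) = 0)"

context
  fixes q :: real and v :: "int \<Rightarrow> real"
  assumes weight: "lattice_weight q v"
begin

lemma lattice_summable_aux:
  "(\<lambda>k. q powi k * v k * ((q powi k) ^ s * poly p (c * q powi k))) summable_on UNIV"
proof (induction p arbitrary: s)
  case (pCons a p)
  have "(\<lambda>k. a * (q powi k * v k * (q powi k) ^ s)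
      + c * (q powi k * v k * ((q powi k) ^ Suc s * poly p (c * q powi k)))) summable_on UNIV"
    using weight unfolding lattice_weight_def
    by (intro summable_on_add summable_on_cmult_right pCons.IH) auto
  then show ?case by (simp add: algebra_simps)
qed simp

lemma lattice_summable:
  "(\<lambda>k. q powi k * v k * (poly p (q powi k) + poly p (- (q powi k)))) summable_on UNIV"
  using summable_on_add[OF lattice_summable_aux[of 0 p 1] lattice_summable_aux[of 0 p "-1"]]
  by (simp add: algebra_simps)

lemma lattice_sum_add: "lattice_sum q v (p + r) = lattice_sum q v p + lattice_sum q v r"
  unfolding lattice_sum_def
  by (subst infsum_add[symmetric, OF lattice_summable lattice_summable]) (simp add: algebra_simps)

lemma lattice_sum_smult: "lattice_sum q v (smult c p) = c * lattice_sum q v p"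
  unfolding lattice_sum_def
  by (subst infsum_cmult_right'[symmetric]) (simp add: algebra_simps)

lemma lattice_sum_sum: "lattice_sum q v (sum f A) = (\<Sum>i\<in>A. lattice_sum q v (f i))"
proof (induction A rule: infinite_finite_induct)
  case (insert x F)
  then show ?case by (simp add: lattice_sum_add)
qed (simp_all add: lattice_sum_def)

lemma lattice_sum_square_nonneg: "0 \<le> lattice_sum q v (p ^ 2)"
  unfolding lattice_sum_def
  by (intro infsum_nonneg mult_nonneg_nonneg) (use weight in \<open>auto simp: lattice_weight_def\<close>)

lemma orthogonal_below_monomI:
  assumes "\<And>i. i < n \<Longrightarrow> lattice_sum q v (T * monom 1 i) = 0"
  shows "orthogonal_below q v T n"
  unfolding orthogonal_below_def
proof safe
  fix D :: "real poly"
  assume D: "\<forall>i\<ge>n. coeff D i = 0"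
  have "D = (\<Sum>i<n. smult (coeff D i) (monom 1 i))"
    by (rule poly_eqI) (use D in \<open>auto simp: coeff_sum not_less if_distrib [of "(*) _"] cong: if_cong\<close>)
  then have "T * D = (\<Sum>i<n. smult (coeff D i) (T * monom 1 i))"
    by (metis (no_types, lifting) mult_smult_right sum.cong sum_distrib_left)
  then have "lattice_sum q v (T * D) = (\<Sum>i<n. coeff D i * lattice_sum q v (T * monom 1 i))"
    by (simp add: lattice_sum_sum lattice_sum_smult)
  then show "lattice_sum q v (T * D) = 0" using assms by simp
qed

lemma orthogonal_below_smult:
  "orthogonal_below q v T n \<Longrightarrow> orthogonal_below q v (smult c T) n"
  by (simp add: orthogonal_below_def lattice_sum_smult)

text \<open>
  An orthogonal family with one member of every degree spans the polynomials: subtracting a multiple of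
  \<open>P j\<close> removes the coefficient of \<open>x\<^sup>j\<close>.
\<close>
lemma orthogonal_below_family:
  assumes deg: "\<And>k. degree (P k) = k \<and> lead_coeff (P k) = 1"
    and orth: "\<And>k. k < n \<Longrightarrow> lattice_sum q v (P n * P k) = 0"
  shows "orthogonal_below q v (P n) n"
proof -
  have "lattice_sum q v (P n * D) = 0" if "j \<le> n" "\<forall>i\<ge>j. coeff D i = 0" for j D
    using that
  proof (induction j arbitrary: D)
    case 0
    then have "D = 0" by (simp add: poly_eq_iff)
    then show ?case by (simp add: lattice_sum_def)
  next
    case (Suc j)
    define D' where "D' = D - smult (coeff D j) (P j)"
    have "coeff D' i = 0" if "i \<ge> j" for i
    proof (cases "i = j")
      case True
      then show ?thesis using deg[of j] by (auto simp: D'_def)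
    next
      case False
      then show ?thesis using deg[of j] Suc.prems(2) that by (simp add: D'_def coeff_eq_0)
    qed
    then have "lattice_sum q v (P n * D') = 0"
      using Suc by simp
    moreover have "P n * D = P n * D' + smult (coeff D j) (P n * P j)"
      by (simp add: D'_def algebra_simps)
    ultimately show ?case
      using Suc.prems(1) orth[of j] by (simp add: lattice_sum_add lattice_sum_smult)
  qed
  then show ?thesis unfolding orthogonal_below_def by blast
qed

text \<open>
  Pythagoras. Agreement of all coefficients from \<open>n\<close> on replaces the usual normalisation of both
  polynomials to be monic, so that the non-monic Stieltjes--Wigert polynomials can be used directly.
\<close>
lemma orthogonal_below_minimal:
  assumes "orthogonal_below q v T n" "\<And>i. i \<ge> n \<Longrightarrow> coeff R i = coeff T i"
  shows "lattice_sum q v (T ^ 2) \<le> lattice_sum q v (R ^ 2)"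
proof -
  have "R ^ 2 = T ^ 2 + (smult 2 (T * (R - T)) + (R - T) ^ 2)"
    by (simp add: power2_eq_square algebra_simps flip: numeral_mult_conv_smult)
  moreover have "lattice_sum q v (T * (R - T)) = 0"
    using assms unfolding orthogonal_below_def by simp
  ultimately show ?thesis
    using lattice_sum_square_nonneg[of "R - T"] by (simp add: lattice_sum_add lattice_sum_smult)
qed

end

section \<open>The weight on the lattice and its theta-function companion\<close>

lemma int_const_if_step:
  fixes u :: "int \<Rightarrow> 'a"
  assumes "\<And>k. u (k + 1) = u k"
  shows "u k = u 0"
proof (induction k rule: int_induct[where k = 0])
  case (step2 i)
  then show ?case using assms[of "i - 1"] by simp
qed (simp_all add: assms)

lemma jackson_integral_eq_lattice_sum:
  "jackson_integral q (\<lambda>x. poly p x * weight q x) = lattice_sum q (\<lambda>k. weight q (q powi k)) p"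
  unfolding jackson_integral_def lattice_sum_def
  by (intro infsum_cong) (simp add: weight_def add_divide_distrib algebra_simps)

text \<open>
  The Gaussian \<open>v k = q\<^bsup>2k(k-1)\<^esup>\<close> solves \<open>v (k + 1) = q\<^bsup>4k\<^esup> v k\<close>, the large-\<open>x\<close> form of the equation
  \<open>w(q x) = (1 + x\<^sup>4) w(x)\<close> at \<open>x = q\<^sup>k\<close>.
\<close>
definition theta_weight :: "real \<Rightarrow> int \<Rightarrow> real" where
  "theta_weight q k = q powi (2 * k * (k - 1))"

definition theta_const :: "real \<Rightarrow> real" where
  "theta_const q = (\<Sum>\<^sub>\<infinity>k\<in>UNIV. q powi k * theta_weight q k)"

context
  fixes q :: real
  assumes q: "0 < q" "q < 1"
begin

lemma powi_collect:
  "q powi a * q powi b = q powi (a + b)" "(q powi a) ^ s = q powi (a * int s)"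
  "q powi a * q ^ s = q powi (a + int s)" "q ^ s * q powi a = q powi (a + int s)"
  "q powi a * (q powi b * x) = q powi (a + b) * x"
  using q by (simp_all add: power_int_add power_int_power' mult.assoc mult.commute)

lemma weight_shift: "weight q (q * x) = (1 + x ^ 4) * weight q x"
proof -
  have b: "0 < q ^ 4" "q ^ 4 < 1" using q by (simp_all add: power_less_one_iff)
  have "qpochhammer_inf (- (x ^ 4)) (q ^ 4) = (1 + x ^ 4) * qpochhammer_inf (- ((q * x) ^ 4)) (q ^ 4)"
    using qpochhammer_inf_shift[OF b, of "- (x ^ 4)"] by (simp add: power_mult_distrib mult.commute)
  moreover have "1 + x ^ 4 > 0" by (smt (verit) zero_le_even_power even_numeral)
  ultimately show ?thesis unfolding weight_def by simp
qed

lemma weight_bounds: "0 < weight q x" "weight q x \<le> 1"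
proof -
  have b: "0 < q ^ 4" "q ^ 4 < 1" using q by (simp_all add: power_less_one_iff)
  have "1 \<le> qpochhammer_inf (- (x ^ 4)) (q ^ 4)"
    by (rule qpochhammer_inf_mono_neg(1)[OF b, where z' = "x ^ 4"]) auto
  then show "0 < weight q x" "weight q x \<le> 1" by (auto simp: weight_def)
qed

text \<open>
  Both sides satisfy the same first-order recurrence in \<open>k\<close>, because
  \<open>1 + q\<^bsup>4k\<^esup> = q\<^bsup>4k\<^esup> (1 + q\<^bsup>-4k\<^esup>)\<close>; hence their quotient is a constant.
\<close>
lemma weight_factorization:
  obtains C where "0 < C"
    "\<And>k. weight q (q powi k) = C * theta_weight q k * qpochhammer_inf (- (q powi (4 - 4 * k))) (q ^ 4)"
proof -
  have b: "0 < q ^ 4" "q ^ 4 < 1" using q by (simp_all add: power_less_one_iff)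
  define E where "E k = qpochhammer_inf (- (q powi (4 - 4 * k))) (q ^ 4)" for k
  have E1: "1 \<le> E k" for k
    unfolding E_def by (rule qpochhammer_inf_mono_neg(1)[OF b _ order_refl]) (use q in auto)
  have Estep: "E (k + 1) = (1 + q powi (- 4 * k)) * E k" for k
    unfolding E_def by (subst qpochhammer_inf_shift[OF b]) (simp add: powi_collect algebra_simps)
  have wstep: "weight q (q powi (k + 1)) = (1 + q powi (4 * k)) * weight q (q powi k)" for k
    using weight_shift[of "q powi k"] q by (simp add: power_int_add powi_collect mult.commute)
  have tstep: "theta_weight q (k + 1) = q powi (4 * k) * theta_weight q k" for k
    by (simp add: theta_weight_def powi_collect algebra_simps)
  have tpos: "theta_weight q k > 0" for k using q by (simp add: theta_weight_def)
  define u where "u k = weight q (q powi k) / (theta_weight q k * E k)" for k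
  have "u (k + 1) = u k" for k
  proof -
    have "theta_weight q (k + 1) * E (k + 1) = (1 + q powi (4 * k)) * (theta_weight q k * E k)"
      unfolding tstep Estep using powi_collect(1)[of "4 * k" "- 4 * k"] by (simp add: algebra_simps)
    moreover have "1 + q powi (4 * k) > 0" using q by (simp add: add_pos_pos)
    ultimately show ?thesis unfolding u_def wstep by simp
  qed
  then have "u k = u 0" for k by (rule int_const_if_step)
  then have "weight q (q powi k) = u 0 * theta_weight q k * E k" for k
    using tpos[of k] E1[of k] unfolding u_def by (smt (verit) mult.assoc nonzero_mult_div_cancel_right times_divide_eq_left mult_pos_pos)
  moreover have "u 0 > 0"
    using tpos[of 0] E1[of 0] weight_bounds(1)[of "q powi 0"] unfolding u_def
    by (intro divide_pos_pos mult_pos_pos) auto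
  ultimately show ?thesis using that unfolding E_def by blast
qed

lemma summable_powi_abs: "(\<lambda>k. q powi \<bar>k\<bar>) summable_on (UNIV :: int set)"
proof -
  have geo: "(\<lambda>n. q ^ n) summable_on (UNIV :: nat set)"
    using q by (subst summable_on_UNIV_nonneg_real_iff) (auto simp: summable_geometric)
  have "(\<lambda>k. q powi \<bar>k\<bar>) summable_on range int"
    by (subst summable_on_reindex) (use geo in \<open>auto simp: o_def\<close>)
  moreover have "(\<lambda>k. q powi \<bar>k\<bar>) summable_on ((\<lambda>n. - int n) ` {1..})"
    by (subst summable_on_reindex)
      (use summable_on_subset_banach[OF geo, of "{1..}"] in \<open>auto simp: o_def inj_on_def\<close>)
  moreover have "range int \<inter> (\<lambda>n. - int n) ` {1..} = {}" by auto
  moreover have "range int \<union> (\<lambda>n. - int n) ` {1..} = UNIV"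
  proof -
    have "k \<in> range int \<union> (\<lambda>n. - int n) ` {1..}" for k
      by (cases k rule: int_cases2) (auto simp: image_iff intro: exI[of _ "nat \<bar>k\<bar>"])
    then show ?thesis by auto
  qed
  ultimately show ?thesis by (metis summable_on_Un_disjoint)
qed

text \<open>
  For \<open>k \<ge> 0\<close> the factor \<open>q\<^sup>k\<close> alone gives convergence. For \<open>k < 0\<close> the infinite product in the
  factorization is bounded, and the Gaussian beats every power.
\<close>
lemma lattice_weight_weight: "lattice_weight q (\<lambda>k. weight q (q powi k))"
proof -
  have b: "0 < q ^ 4" "q ^ 4 < 1" using q by (simp_all add: power_less_one_iff)
  obtain C where C: "0 < C" "\<And>k. weight q (q powi k) =
      C * theta_weight q k * qpochhammer_inf (- (q powi (4 - 4 * k))) (q ^ 4)"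
    by (rule weight_factorization) blast
  define H where "H = qpochhammer_inf (- 1) (q ^ 4)"
  have H: "1 \<le> H" using qpochhammer_inf_mono_neg(1)[OF b, of 1 1] by (simp add: H_def)
  have "(\<lambda>k. q powi k * weight q (q powi k) * (q powi k) ^ s) summable_on UNIV" for s
  proof (rule summable_on_comparison_test)
    define B where "B = 1 + C * H * q powi (- (int s)\<^sup>2)"
    show "(\<lambda>k. B * q powi \<bar>k\<bar>) summable_on UNIV"
      by (intro summable_on_cmult_right summable_powi_abs)
    fix k :: int
    show "0 \<le> q powi k * weight q (q powi k) * (q powi k) ^ s"
      using q weight_bounds(1)[of "q powi k"] by auto
    have B1: "1 \<le> B" "C * H * q powi (- (int s)\<^sup>2) \<le> B"
      unfolding B_def using q C(1) H by auto
    show "q powi k * weight q (q powi k) * (q powi k) ^ s \<le> B * q powi \<bar>k\<bar>"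
    proof (cases "k \<ge> 0")
      case True
      have "(q powi k) ^ s \<le> 1"
        using q True by (intro power_le_one power_int_le_one) auto
      then have "weight q (q powi k) * (q powi k) ^ s \<le> 1 * 1"
        using weight_bounds[of "q powi k"] q by (intro mult_mono) auto
      then have "q powi k * (weight q (q powi k) * (q powi k) ^ s) \<le> q powi k * B"
        using B1(1) q by (intro mult_left_mono) auto
      then show ?thesis using True by (simp add: mult_ac)
    next
      case False
      define l where "l = - k"
      have l: "k = - l" "0 < l" using False by (auto simp: l_def)
      have "q powi (4 - 4 * k) \<le> 1" using q l by (intro power_int_le_one) auto
      then have "qpochhammer_inf (- (q powi (4 - 4 * k))) (q ^ 4) \<le> H"
        unfolding H_def using qpochhammer_inf_mono_neg(2)[OF b, of "q powi (4 - 4 * k)" 1] q by simp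
      then have "weight q (q powi k) \<le> C * theta_weight q k * H"
        unfolding C(2) using C(1) q by (intro mult_left_mono) (auto simp: theta_weight_def)
      then have "q powi k * weight q (q powi k) * (q powi k) ^ s
          \<le> q powi k * (C * theta_weight q k * H) * (q powi k) ^ s"
        using q by (intro mult_right_mono mult_left_mono) auto
      also have "\<dots> = C * H * q powi (k + 2 * k * (k - 1) + k * int s)"
        by (simp add: theta_weight_def powi_collect algebra_simps)
      also have "\<dots> \<le> C * H * q powi (- (int s)\<^sup>2 + \<bar>k\<bar>)"
      proof -
        have "0 \<le> 2 * l\<^sup>2 - l * int s + (int s)\<^sup>2"
        proof -
          \<comment> \<open>The constant \<open>q powi - s\<^sup>2\<close> in \<open>B\<close> is chosen to make this quadratic form nonnegative.\<close>
          have "2 * (2 * l\<^sup>2 - l * int s + (int s)\<^sup>2) = (l - int s)\<^sup>2 + 3 * l\<^sup>2 + (int s)\<^sup>2"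
            by (simp add: power2_eq_square algebra_simps)
          also have "\<dots> \<ge> 0" by simp
          finally show ?thesis by simp
        qed
        moreover have "l + (2 * l\<^sup>2 - l * int s) = k + 2 * k * (k - 1) + k * int s"
          by (simp add: l power2_eq_square algebra_simps)
        ultimately have "- (int s)\<^sup>2 + \<bar>k\<bar> \<le> k + 2 * k * (k - 1) + k * int s"
          using l by linarith
        then show ?thesis using q C(1) H by (intro mult_left_mono power_int_decreasing) auto
      qed
      also have "\<dots> = C * H * q powi (- (int s)\<^sup>2) * q powi \<bar>k\<bar>"
        by (simp only: powi_collect(1) mult.assoc)
      also have "\<dots> \<le> B * q powi \<bar>k\<bar>" using B1 q by (intro mult_right_mono) auto
      finally show ?thesis .
    qed
  qed
  then show ?thesis unfolding lattice_weight_def using q weight_bounds(1) by (simp add: less_imp_le)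
qed

lemma lattice_weight_theta: "lattice_weight q (theta_weight q)"
proof -
  have b: "0 < q ^ 4" "q ^ 4 < 1" using q by (simp_all add: power_less_one_iff)
  obtain C where C: "0 < C" "\<And>k. weight q (q powi k) =
      C * theta_weight q k * qpochhammer_inf (- (q powi (4 - 4 * k))) (q ^ 4)"
    by (rule weight_factorization) blast
  have le: "theta_weight q k \<le> inverse C * weight q (q powi k)" for k
  proof -
    have "1 \<le> qpochhammer_inf (- (q powi (4 - 4 * k))) (q ^ 4)"
      by (rule qpochhammer_inf_mono_neg(1)[OF b _ order_refl]) (use q in auto)
    then have "theta_weight q k * 1 \<le> theta_weight q k * qpochhammer_inf (- (q powi (4 - 4 * k))) (q ^ 4)"
      using q by (intro mult_left_mono) (auto simp: theta_weight_def)
    then show ?thesis unfolding C(2) using C(1) by (simp add: field_simps)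
  qed
  have "(\<lambda>k. q powi k * theta_weight q k * (q powi k) ^ s) summable_on UNIV" for s
  proof (rule summable_on_comparison_test)
    show "(\<lambda>k. inverse C * (q powi k * weight q (q powi k) * (q powi k) ^ s)) summable_on UNIV"
      using lattice_weight_weight unfolding lattice_weight_def
      by (intro summable_on_cmult_right) auto
    fix k
    show "0 \<le> q powi k * theta_weight q k * (q powi k) ^ s" using q by (auto simp: theta_weight_def)
    show "q powi k * theta_weight q k * (q powi k) ^ s
        \<le> inverse C * (q powi k * weight q (q powi k) * (q powi k) ^ s)"
      using mult_left_mono[OF le[of k], of "q powi k * (q powi k) ^ s"] q by (simp add: mult_ac)
  qed
  then show ?thesis unfolding lattice_weight_def using q by (auto simp: theta_weight_def)
qed

text \<open>
  Translating \<open>k\<close> by one relates the moments \<open>s\<close> and \<open>s + 4\<close>. The reflection \<open>k \<mapsto> - k\<close> identifies the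
  moments \<open>0\<close> and \<open>2\<close>, whose exponents are \<open>2k\<^sup>2 - k\<close> and \<open>2k\<^sup>2 + k\<close>; it is this coincidence that turns
  the two chains of even moments into a single log-normal sequence.
\<close>
lemma theta_moment_recurrence:
  fixes s :: nat
  defines "M \<equiv> \<lambda>s. (\<Sum>\<^sub>\<infinity>k\<in>UNIV. q powi k * theta_weight q k * (q powi k) ^ s)"
  shows "M 0 = theta_const q" "M 2 = theta_const q" "M (s + 4) = M s / q ^ Suc s"
proof -
  show M0: "M 0 = theta_const q" by (simp add: M_def theta_const_def)
  have "M 2 = (\<Sum>\<^sub>\<infinity>k\<in>UNIV. q powi (- k) * theta_weight q (- k) * (q powi (- k)) ^ 2)"
    unfolding M_def
    by (rule infsum_reindex_bij_witness[of _ uminus uminus]) auto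
  also have "\<dots> = M 0"
    unfolding M_def
    by (intro infsum_cong) (simp add: theta_weight_def powi_collect algebra_simps del: power_int_minus)
  finally show "M 2 = theta_const q" using M0 by simp
  have "M (s + 4) = (\<Sum>\<^sub>\<infinity>k\<in>UNIV. (q powi (k + 1) * theta_weight q (k + 1) * (q powi (k + 1)) ^ s) * q powi (- int (Suc s)))"
    unfolding M_def
    by (intro infsum_cong) (simp add: theta_weight_def powi_collect algebra_simps del: power_int_minus)
  also have "\<dots> = (\<Sum>\<^sub>\<infinity>k\<in>UNIV. q powi (k + 1) * theta_weight q (k + 1) * (q powi (k + 1)) ^ s) * q powi (- int (Suc s))"
    by (rule infsum_cmult_left')
  also have "(\<Sum>\<^sub>\<infinity>k\<in>UNIV. q powi (k + 1) * theta_weight q (k + 1) * (q powi (k + 1)) ^ s) = M s"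
    unfolding M_def
    by (rule infsum_reindex_bij_witness[of _ "\<lambda>k. k - 1" "\<lambda>k. k + 1"]) auto
  also have "M s * q powi (- int (Suc s)) = M s / q ^ Suc s"
    by (simp only: power_int_minus power_int_of_nat divide_inverse)
  finally show "M (s + 4) = M s / q ^ Suc s" .
qed

lemma theta_moments:
  "lattice_sum q (theta_weight q) (monom 1 (2 * j)) = 2 * theta_const q / q ^ (j choose 2)"
  "lattice_sum q (theta_weight q) (monom 1 (Suc (2 * j))) = 0"
proof -
  show "lattice_sum q (theta_weight q) (monom 1 (Suc (2 * j))) = 0"
    by (simp add: lattice_sum_def poly_monom)
  define M where "M s = (\<Sum>\<^sub>\<infinity>k\<in>UNIV. q powi k * theta_weight q k * (q powi k) ^ s)" for s :: nat
  note rec = theta_moment_recurrence[folded M_def]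
  have "M (2 * j) = theta_const q / q ^ (j choose 2) \<and>
        M (2 * Suc j) = theta_const q / q ^ (Suc j choose 2)"
  proof (induction j)
    case 0
    then show ?case using rec(1,2) by (simp add: binomial_eq_0 numeral_2_eq_2)
  next
    case (Suc j)
    have "M (2 * Suc (Suc j)) = M (2 * j) / q ^ Suc (2 * j)"
      using rec(3)[of "2 * j"] by (simp add: algebra_simps eval_nat_numeral)
    moreover have "Suc (Suc j) choose 2 = (j choose 2) + Suc (2 * j)"
      by (simp add: Suc_choose_2)
    ultimately show ?case using Suc by (simp add: power_add)
  qed
  moreover have "lattice_sum q (theta_weight q) (monom 1 (2 * j)) = 2 * M (2 * j)"
    unfolding lattice_sum_def M_def
    by (subst infsum_cmult_right'[symmetric]) (simp add: poly_monom algebra_simps)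
  ultimately show "lattice_sum q (theta_weight q) (monom 1 (2 * j)) = 2 * theta_const q / q ^ (j choose 2)"
    by simp
qed

text \<open>
  The term at \<open>k = 0\<close> is \<open>1\<close>.
\<close>
lemma theta_const_pos: "0 < theta_const q"
proof -
  have "(\<lambda>k. q powi k * theta_weight q k) summable_on UNIV"
    using lattice_weight_theta unfolding lattice_weight_def by (metis (no_types, lifting) mult.right_neutral power_0 summable_on_cong)
  then have "(\<Sum>k\<in>{0}. q powi k * theta_weight q k) \<le> theta_const q"
    unfolding theta_const_def using q
    by (intro finite_sum_le_infsum) (auto simp: theta_weight_def)
  then show ?thesis by (simp add: theta_weight_def)
qed

end

section \<open>Stieltjes--Wigert polynomials\<close>

text \<open>
  For \<open>t = 1\<close> this is \<open>x\<^sup>d s(x\<^sup>2)\<close> with \<open>s\<close> a Stieltjes--Wigert polynomial of degree \<open>m\<close> in base \<open>q\<close>. The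
  parameter \<open>t\<close> rescales the argument of \<open>s\<close>, and the normalisation makes the constant coefficient of \<open>s\<close>
  equal to \<open>1\<close>, in which form the norms of all rescalings are easiest to compare.
\<close>
definition sw_poly :: "real \<Rightarrow> real \<Rightarrow> nat \<Rightarrow> nat \<Rightarrow> real poly" where
  "sw_poly q t d m = (\<Sum>i\<le>m. monom ((-1) ^ i * qbinomial q m i * q ^ (2 * (i choose 2) + d * i) * t ^ i) (2 * i + d))"

lemma coeff_sw_poly:
  "coeff (sw_poly q t d m) (2 * m + d) = (-1) ^ m * q ^ (2 * (m choose 2) + d * m) * t ^ m"
  "j > 2 * m + d \<Longrightarrow> coeff (sw_poly q t d m) j = 0"
  by (auto simp: sw_poly_def coeff_sum qbinomial_self cong: if_cong)

text \<open>
  It turns a lattice step \<open>x \<mapsto> q\<^sup>r x\<close> into the parameter \<open>t = q\<^bsup>2r\<^esup>\<close>, up to the factor \<open>q\<^bsup>rd\<^esup>\<close>.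
\<close>
lemma poly_sw_poly_scale:
  "poly (sw_poly q 1 d m) (s * x) = s ^ d * poly (sw_poly q (s ^ 2) d m) x"
  unfolding sw_poly_def poly_sum poly_monom sum_distrib_left
  by (intro sum.cong refl)
    (simp add: power_mult_distrib power_add power_mult [symmetric] mult_ac)

context
  fixes q :: real
  assumes q: "0 < q" "q < 1"
begin

text \<open>
  Pulling \<open>- q\<^bsup>-j\<^esup>\<close> out of the factor \<open>1 - q\<^bsup>-j\<^esup>\<close>, for \<open>j = 1, \<dots>, m\<close>.
\<close>
lemma qpochhammer_inverse_power:
  "(-1) ^ m * q ^ (m choose 2) * qpochhammer (1 / q ^ m) q m = qpochhammer q q m / q ^ m"
proof (induction m)
  case (Suc m)
  have "qpochhammer (1 / q ^ Suc m) q (Suc m) = (1 - 1 / q ^ Suc m) * qpochhammer (1 / q ^ m) q m"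
    using q by (subst qpochhammer_Suc_shift) simp
  moreover have "(-1) ^ Suc m * q ^ (Suc m choose 2) * ((1 - x) * y)
      = q ^ m * (x - 1) * ((-1) ^ m * q ^ (m choose 2) * y)" for x y
    by (simp add: Suc_choose_2 power_add algebra_simps)
  ultimately have "(-1) ^ Suc m * q ^ (Suc m choose 2) * qpochhammer (1 / q ^ Suc m) q (Suc m)
      = q ^ m * (1 / q ^ Suc m - 1) * ((-1) ^ m * q ^ (m choose 2) * qpochhammer (1 / q ^ m) q m)"
    by metis
  also have "\<dots> = (1 / q ^ Suc m - 1) * qpochhammer q q m"
    unfolding Suc.IH using q by simp
  also have "\<dots> = qpochhammer q q (Suc m) / q ^ Suc m"
    using q by (simp add: qpochhammer_def field_simps)
  finally show ?case .
qed (simp add: qpochhammer_def binomial_eq_0)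

text \<open>
  The moment of order \<open>2 (k + i + d)\<close> contributes \<open>q\<close> to the power \<open>- (k + i + d choose 2)\<close>, which
  cancels one of the two copies of \<open>k choose 2\<close> in the coefficient of \<open>x\<^bsup>2k+d\<^esup>\<close>. What remains is the \<open>q\<close>-binomial sum at
  \<open>t / q\<^sup>i\<close>. For \<open>d \<in> {0, 1}\<close> the number \<open>d choose 2\<close> vanishes, which is why both parities give the same answer.
\<close>
lemma sw_poly_pairing:
  assumes "d \<le> 1"
  shows "lattice_sum q (theta_weight q) (sw_poly q t d m * monom 1 (2 * i + d))
    = 2 * theta_const q / q ^ ((i choose 2) + d * i) * qpochhammer (t / q ^ i) q m"
    "lattice_sum q (theta_weight q) (sw_poly q t d m * monom 1 (2 * i + (1 - d))) = 0"
proof -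
  note lw = lattice_weight_theta[OF q]
  define a where "a k = (-1) ^ k * qbinomial q m k * q ^ (2 * (k choose 2) + d * k) * t ^ k" for k
  have prod: "sw_poly q t d m * monom 1 j = (\<Sum>k\<le>m. smult (a k) (monom 1 (2 * k + d + j)))" for j
    by (simp add: sw_poly_def a_def sum_distrib_right mult_monom smult_monom)
  have "2 * k + d + (2 * i + (1 - d)) = Suc (2 * (k + i))" for k using assms by simp
  then show "lattice_sum q (theta_weight q) (sw_poly q t d m * monom 1 (2 * i + (1 - d))) = 0"
    unfolding prod lattice_sum_sum[OF lw] lattice_sum_smult[OF lw] by (simp only: theta_moments[OF q]) simp
  have e: "2 * k + d + (2 * i + d) = 2 * (k + i + d)" for k by simp
  have c: "k + i + d choose 2 = (k choose 2) + (i choose 2) + k * i + d * k + d * i" for k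
  proof -
    consider "d = 0" | "d = 1" using assms by linarith
    then show ?thesis by cases (simp_all add: Suc_choose_2 add_choose_2)
  qed
  have "lattice_sum q (theta_weight q) (sw_poly q t d m * monom 1 (2 * i + d))
      = (\<Sum>k\<le>m. a k * (2 * theta_const q / q ^ (k + i + d choose 2)))"
    unfolding prod lattice_sum_sum[OF lw] lattice_sum_smult[OF lw] e theta_moments[OF q] ..
  also have "\<dots> = (\<Sum>k\<le>m. 2 * theta_const q / q ^ ((i choose 2) + d * i) *
        ((-1) ^ k * qbinomial q m k * q ^ (k choose 2) * (t / q ^ i) ^ k))"
  proof (rule sum.cong)
    fix k
    have "q ^ (k + i + d choose 2)
        = q ^ (k choose 2) * q ^ (k * i) * q ^ (d * k) * q ^ ((i choose 2) + d * i)"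
      unfolding c by (simp add: power_add mult_ac)
    moreover have "(t / q ^ i) ^ k = t ^ k / q ^ (k * i)"
      by (simp only: power_divide power_mult [symmetric] mult.commute)
    moreover have "a k = (-1) ^ k * qbinomial q m k * (q ^ (k choose 2) * q ^ (k choose 2) * q ^ (d * k)) * t ^ k"
      by (simp add: a_def power_add mult_2)
    ultimately show "a k * (2 * theta_const q / q ^ (k + i + d choose 2))
        = 2 * theta_const q / q ^ ((i choose 2) + d * i) *
          ((-1) ^ k * qbinomial q m k * q ^ (k choose 2) * (t / q ^ i) ^ k)"
      using q by (simp add: mult_ac)
  qed simp
  also have "\<dots> = 2 * theta_const q / q ^ ((i choose 2) + d * i) * qpochhammer (t / q ^ i) q m"
    unfolding qpochhammer_expand by (simp add: sum_distrib_left)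
  finally show "lattice_sum q (theta_weight q) (sw_poly q t d m * monom 1 (2 * i + d))
    = 2 * theta_const q / q ^ ((i choose 2) + d * i) * qpochhammer (t / q ^ i) q m" .
qed

text \<open>
  For \<open>t = 1\<close> and \<open>i < m\<close> the product \<open>(q\<^bsup>-i\<^esup>; q)\<^sub>m\<close> contains the factor \<open>1 - q\<^bsup>-i\<^esup> q\<^sup>i = 0\<close>; powers of the
  other parity pair to zero by symmetry.
\<close>
lemma sw_poly_orthogonal:
  assumes "d \<le> 1"
  shows "orthogonal_below q (theta_weight q) (sw_poly q 1 d m) (2 * m + d)"
proof (rule orthogonal_below_monomI[OF lattice_weight_theta[OF q]])
  fix a assume a: "a < 2 * m + d"
  have "(\<exists>i<m. a = 2 * i + d) \<or> (\<exists>i. a = 2 * i + (1 - d))"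
  proof -
    consider "d = 0" | "d = 1" using assms by linarith
    then show ?thesis
    proof cases
      case 1
      then show ?thesis using a by (cases "even a") (auto elim!: evenE oddE)
    next
      case 2
      then show ?thesis using a by (cases "even a") (auto elim!: evenE oddE)
    qed
  qed
  then show "lattice_sum q (theta_weight q) (sw_poly q 1 d m * monom 1 a) = 0"
  proof (elim disjE exE conjE)
    fix i assume i: "i < m" "a = 2 * i + d"
    have "qpochhammer (1 / q ^ i) q m = 0"
      by (rule qpochhammer_eq_0[OF i(1)]) (use q in simp)
    then show ?thesis unfolding i(2) sw_poly_pairing(1)[OF assms] by simp
  qed (simp only: sw_poly_pairing(2)[OF assms])
qed

lemma sw_poly_square:
  assumes "d \<le> 1"
  shows "lattice_sum q (theta_weight q) (sw_poly q t d m ^ 2) = 2 * theta_const q *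
    (\<Sum>i\<le>m. (-1) ^ i * qbinomial q m i * q ^ (i choose 2) * t ^ i * qpochhammer (t / q ^ i) q m)"
proof -
  note lw = lattice_weight_theta[OF q]
  define a where "a k = (-1) ^ k * qbinomial q m k * q ^ (2 * (k choose 2) + d * k) * t ^ k" for k
  have "sw_poly q t d m = (\<Sum>k\<le>m. smult (a k) (monom 1 (2 * k + d)))"
    by (simp add: sw_poly_def a_def smult_monom)
  then have "sw_poly q t d m ^ 2 = (\<Sum>k\<le>m. smult (a k) (sw_poly q t d m * monom 1 (2 * k + d)))"
    by (metis (no_types, lifting) mult_smult_right power2_eq_square sum.cong sum_distrib_left)
  then have "lattice_sum q (theta_weight q) (sw_poly q t d m ^ 2)
      = (\<Sum>k\<le>m. a k * (2 * theta_const q / q ^ ((k choose 2) + d * k) * qpochhammer (t / q ^ k) q m))"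
    by (metis (no_types, lifting) lattice_sum_sum[OF lw] lattice_sum_smult[OF lw] sw_poly_pairing(1)[OF assms] sum.cong)
  also have "\<dots> = 2 * theta_const q *
    (\<Sum>i\<le>m. (-1) ^ i * qbinomial q m i * q ^ (i choose 2) * t ^ i * qpochhammer (t / q ^ i) q m)"
    unfolding sum_distrib_left
  proof (rule sum.cong)
    fix k
    have split: "a k = (-1) ^ k * qbinomial q m k * q ^ (k choose 2) * t ^ k * q ^ ((k choose 2) + d * k)"
      by (simp add: a_def power_add mult_2)
    have "x * y * (c / y * z) = c * (x * z)" if "y \<noteq> 0" for x y c z :: real
      using that by simp
    then show "a k * (2 * theta_const q / q ^ ((k choose 2) + d * k) * qpochhammer (t / q ^ k) q m)
        = 2 * theta_const q * ((-1) ^ k * qbinomial q m k * q ^ (k choose 2) * t ^ k * qpochhammer (t / q ^ k) q m)"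
      unfolding split using q by simp
  qed simp
  finally show ?thesis .
qed

text \<open>
  Only the term \<open>i = m\<close> of the expansion of the square survives.
\<close>
lemma sw_poly_norm:
  assumes "d \<le> 1"
  shows "lattice_sum q (theta_weight q) (sw_poly q 1 d m ^ 2) = 2 * theta_const q * qpochhammer q q m / q ^ m"
proof -
  have "(\<Sum>i\<le>m. (-1) ^ i * qbinomial q m i * q ^ (i choose 2) * 1 ^ i * qpochhammer (1 / q ^ i) q m)
      = (\<Sum>i\<in>{m}. (-1) ^ i * qbinomial q m i * q ^ (i choose 2) * 1 ^ i * qpochhammer (1 / q ^ i) q m)"
  proof (rule sum.mono_neutral_right)
    show "\<forall>i\<in>{..m} - {m}. (-1) ^ i * qbinomial q m i * q ^ (i choose 2) * 1 ^ i * qpochhammer (1 / q ^ i) q m = 0"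
    proof
      fix i assume "i \<in> {..m} - {m}"
      then have "qpochhammer (1 / q ^ i) q m = 0"
        using q by (intro qpochhammer_eq_0[of i]) auto
      then show "(-1) ^ i * qbinomial q m i * q ^ (i choose 2) * 1 ^ i * qpochhammer (1 / q ^ i) q m = 0"
        by simp
    qed
  qed auto
  also have "\<dots> = qpochhammer q q m / q ^ m"
    using qpochhammer_inverse_power[of m] by (simp add: qbinomial_self)
  finally show ?thesis unfolding sw_poly_square[OF assms] by simp
qed

text \<open>
  The decisive estimate: rescaling the argument by a lattice step destroys the growth \<open>q\<^bsup>-m\<^esup>\<close> of the norm.
  For \<open>t = q\<^bsup>2r\<^esup>\<close> the factor \<open>(q\<^bsup>2r-i\<^esup>; q)\<^sub>m\<close> lies in \<open>[0, 1]\<close> for \<open>i < 2 r\<close> and vanishes for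
  \<open>2 r \<le> i < 2 r + m\<close>. When \<open>r \<ge> 1\<close> this covers all \<open>i \<le> m\<close>, including the term \<open>i = m\<close> that produces
  the norm for \<open>r = 0\<close>.
\<close>
lemma sw_poly_scaled_norm:
  assumes "d \<le> 1" "1 \<le> r"
  shows "lattice_sum q (theta_weight q) (sw_poly q (q ^ (2 * r)) d m ^ 2)
    \<le> 2 * theta_const q * qpochhammer_inf (- 1) q"
proof -
  define t where "t = q ^ (2 * r)"
  have t: "0 \<le> t" "t \<le> 1" using q by (auto simp: t_def power_le_one)
  have bnd: "\<bar>qpochhammer (t / q ^ i) q m\<bar> \<le> 1" if "i \<le> m" for i
  proof (cases "i < 2 * r")
    case True
    have "t / q ^ i = q ^ (2 * r - i)" using q True by (simp add: t_def power_diff)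
    then have "0 \<le> t / q ^ i * q ^ j \<and> t / q ^ i * q ^ j \<le> 1" for j
      using q by (auto intro!: mult_le_one power_le_one)
    then show ?thesis unfolding qpochhammer_def abs_prod by (intro prod_le_1) (auto simp: abs_le_iff)
  next
    case False
    have "t / q ^ i * q ^ (i - 2 * r) = 1" using q False by (simp add: t_def power_diff)
    then have "qpochhammer (t / q ^ i) q m = 0"
      using that assms(2) False by (intro qpochhammer_eq_0[of "i - 2 * r"]) auto
    then show ?thesis by simp
  qed
  have abs_signed: "\<bar>(-1) ^ i * y * z\<bar> = y * \<bar>z\<bar>" if "0 \<le> y" for y z :: real and i :: nat
    using that by (simp add: abs_mult power_abs)
  have "(\<Sum>i\<le>m. (-1) ^ i * qbinomial q m i * q ^ (i choose 2) * t ^ i * qpochhammer (t / q ^ i) q m)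
      \<le> (\<Sum>i\<le>m. qbinomial q m i * q ^ (i choose 2) * t ^ i)"
  proof (rule sum_mono)
    fix i assume i: "i \<in> {..m}"
    have nn: "0 \<le> qbinomial q m i * q ^ (i choose 2) * t ^ i"
      using q t qbinomial_nonneg[of q m i] by auto
    have "(-1) ^ i * qbinomial q m i * q ^ (i choose 2) * t ^ i * qpochhammer (t / q ^ i) q m
        \<le> \<bar>(-1) ^ i * (qbinomial q m i * q ^ (i choose 2) * t ^ i) * qpochhammer (t / q ^ i) q m\<bar>"
      by (simp add: mult.assoc)
    also have "\<dots> = (qbinomial q m i * q ^ (i choose 2) * t ^ i) * \<bar>qpochhammer (t / q ^ i) q m\<bar>"
      using abs_signed[OF nn] .
    also have "\<dots> \<le> (qbinomial q m i * q ^ (i choose 2) * t ^ i) * 1"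
      using nn bnd i by (intro mult_left_mono) auto
    finally show "(-1) ^ i * qbinomial q m i * q ^ (i choose 2) * t ^ i * qpochhammer (t / q ^ i) q m
        \<le> qbinomial q m i * q ^ (i choose 2) * t ^ i" by simp
  qed
  also have "\<dots> = qpochhammer (- t) q m"
    unfolding q_binomial_theorem[symmetric] by (simp add: qpochhammer_def)
  also have "\<dots> \<le> qpochhammer_inf (- t) q" by (rule qpochhammer_inf_ge_partial[OF q t(1)])
  also have "\<dots> \<le> qpochhammer_inf (- 1) q" by (rule qpochhammer_inf_mono_neg(2)[OF q t])
  finally show ?thesis
    unfolding sw_poly_square[OF assms(1)] t_def[symmetric]
    using theta_const_pos[OF q] by (intro mult_left_mono) auto
qed

section \<open>Comparing the two functionals\<close>

text \<open>
  The tilt \<open>Q\<^bsup>r(r+1)/2\<^esup> q\<^bsup>-4kr\<^esup>\<close> of the Gaussian is a Gaussian translated by \<open>r\<close>, up to the factor \<open>q\<^sup>r\<close>. It is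
  stated for finite sums so that it can be summed over \<open>r\<close> before any limit is taken.
\<close>
lemma theta_tilt_bound:
  fixes F :: "int set"
  assumes F: "finite F" and S: "\<And>x. (poly T (q ^ r * x))\<^sup>2 \<le> (poly S x)\<^sup>2"
  shows "(\<Sum>k\<in>F. q powi k * theta_weight q k * ((q ^ 4) ^ (r choose 2) * (q powi (4 - 4 * k)) ^ r) *
            ((poly T (q powi k))\<^sup>2 + (poly T (- (q powi k)))\<^sup>2))
         \<le> q ^ r * lattice_sum q (theta_weight q) (S ^ 2)"
proof -
  note lw = lattice_weight_theta[OF q]
  have four: "int (4 * (r choose 2)) = 2 * int r * int r - 2 * int r"
    by (induction r) (simp_all add: Suc_choose_2 algebra_simps binomial_eq_0)
  have tilt: "q powi k * theta_weight q k * ((q ^ 4) ^ (r choose 2) * (q powi (4 - 4 * k)) ^ r)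
      = q ^ r * (q powi (k - int r) * theta_weight q (k - int r))" for k
  proof -
    have "(q ^ 4) ^ (r choose 2) = q powi (2 * int r * int r - 2 * int r)"
      by (metis four power_int_of_nat power_mult)
    moreover have "q ^ r = q powi int r" by simp
    ultimately show ?thesis
      by (simp add: theta_weight_def powi_collect[OF q] algebra_simps del: power_int_of_nat)
  qed
  have shift: "q ^ r * q powi (k - int r) = q powi k" for k
    by (simp add: powi_collect[OF q])
  have "(\<Sum>k\<in>F. q powi k * theta_weight q k * ((q ^ 4) ^ (r choose 2) * (q powi (4 - 4 * k)) ^ r) *
            ((poly T (q powi k))\<^sup>2 + (poly T (- (q powi k)))\<^sup>2))
     = (\<Sum>k\<in>(\<lambda>k. k - int r) ` F. q ^ r * (q powi k * theta_weight q k) *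
            ((poly T (q ^ r * q powi k))\<^sup>2 + (poly T (q ^ r * (- (q powi k))))\<^sup>2))"
    unfolding tilt by (subst sum.reindex) (simp_all add: inj_on_def shift)
  also have "\<dots> \<le> (\<Sum>k\<in>(\<lambda>k. k - int r) ` F. q ^ r * (q powi k * theta_weight q k *
            (poly (S ^ 2) (q powi k) + poly (S ^ 2) (- (q powi k)))))"
    using q unfolding mult.assoc poly_power
    by (intro sum_mono mult_left_mono add_mono S) (auto simp: theta_weight_def)
  also have "\<dots> = q ^ r * (\<Sum>k\<in>(\<lambda>k. k - int r) ` F. q powi k * theta_weight q k *
            (poly (S ^ 2) (q powi k) + poly (S ^ 2) (- (q powi k))))"
    by (simp add: sum_distrib_left)
  also have "\<dots> \<le> q ^ r * lattice_sum q (theta_weight q) (S ^ 2)"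
    unfolding lattice_sum_def using q F
    by (intro mult_left_mono finite_sum_le_infsum lattice_summable[OF lw]) (auto simp: theta_weight_def)
  finally show ?thesis .
qed

context
  fixes C :: real
  assumes C: "0 < C"
    "\<And>k. weight q (q powi k) = C * theta_weight q k * qpochhammer_inf (- (q powi (4 - 4 * k))) (q ^ 4)"
begin

lemma weight_sum_lower:
  "C * lattice_sum q (theta_weight q) (p ^ 2) \<le> lattice_sum q (\<lambda>k. weight q (q powi k)) (p ^ 2)"
proof -
  have b: "0 < q ^ 4" "q ^ 4 < 1" using q by (simp_all add: power_less_one_iff)
  have le: "C * theta_weight q k \<le> weight q (q powi k)" for k
  proof -
    have "1 \<le> qpochhammer_inf (- (q powi (4 - 4 * k))) (q ^ 4)"
      by (rule qpochhammer_inf_mono_neg(1)[OF b _ order_refl]) (use q in auto)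
    then have "C * theta_weight q k * 1 \<le> weight q (q powi k)"
      unfolding C(2) using C(1) q by (intro mult_left_mono) (auto simp: theta_weight_def)
    then show ?thesis by simp
  qed
  show ?thesis
    unfolding lattice_sum_def infsum_cmult_right' [symmetric]
  proof (intro infsum_mono)
    show "(\<lambda>k. C * (q powi k * theta_weight q k * (poly (p ^ 2) (q powi k) + poly (p ^ 2) (- (q powi k)))))
        summable_on UNIV"
      by (intro summable_on_cmult_right lattice_summable lattice_weight_theta q)
    show "(\<lambda>k. q powi k * weight q (q powi k) * (poly (p ^ 2) (q powi k) + poly (p ^ 2) (- (q powi k))))
        summable_on UNIV"
      by (intro lattice_summable lattice_weight_weight q)
    fix k :: int
    show "C * (q powi k * theta_weight q k * (poly (p ^ 2) (q powi k) + poly (p ^ 2) (- (q powi k))))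
        \<le> q powi k * weight q (q powi k) * (poly (p ^ 2) (q powi k) + poly (p ^ 2) (- (q powi k)))"
      using mult_left_mono[OF le[of k], of "q powi k * (poly (p ^ 2) (q powi k) + poly (p ^ 2) (- (q powi k)))"] q
      by (simp add: mult_ac)
  qed
qed

text \<open>
  The infinite product in the weight is replaced by its partial products and the lattice by a finite set;
  then the \<open>q\<close>-binomial theorem and an exchange of finite sums suffice, and the bound is uniform in both
  truncations.
\<close>
lemma weight_sum_upper:
  assumes S: "\<And>r x. (poly T (q ^ r * x))\<^sup>2 \<le> (poly (S r) x)\<^sup>2" and "S 0 = T"
    and B: "\<And>r. 1 \<le> r \<Longrightarrow> lattice_sum q (theta_weight q) (S r ^ 2) \<le> B"
  shows "lattice_sum q (\<lambda>k. weight q (q powi k)) (T ^ 2)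
    \<le> C * (lattice_sum q (theta_weight q) (T ^ 2) + B / (qpochhammer_inf (q ^ 4) (q ^ 4) * (1 - q)))"
proof -
  have b: "0 < q ^ 4" "q ^ 4 < 1" using q by (simp_all add: power_less_one_iff)
  note lt = lattice_weight_theta[OF q] and lw = lattice_weight_weight[OF q]
  define L where "L = lattice_sum q (theta_weight q)"
  define K where "K = 1 / qpochhammer_inf (q ^ 4) (q ^ 4)"
  have K: "0 < K" "qbinomial (q ^ 4) J r \<le> K" for J r
  proof -
    note i = qpochhammer_inf_rate[OF b]
    show "0 < K" using i(1) by (simp add: K_def)
    have "qbinomial (q ^ 4) J r * qpochhammer_inf (q ^ 4) (q ^ 4)
        \<le> qbinomial (q ^ 4) J r * qpochhammer (q ^ 4) (q ^ 4) r"
      using q by (intro mult_left_mono i qbinomial_nonneg) auto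
    also have "\<dots> \<le> 1" by (rule qbinomial_le[OF b])
    finally show "qbinomial (q ^ 4) J r \<le> K" using i(1) by (simp add: K_def field_simps)
  qed
  have B0: "0 \<le> B" using B[of 1] lattice_sum_square_nonneg[OF lt, of "S 1"] by simp
  define g where "g k = (poly T (q powi k))\<^sup>2 + (poly T (- (q powi k)))\<^sup>2" for k
  have g: "0 \<le> g k" for k by (simp add: g_def)
  have partial: "(\<Sum>k\<in>F. q powi k * theta_weight q k * qpochhammer (- (q powi (4 - 4 * k))) (q ^ 4) J * g k)
      \<le> L (T ^ 2) + K * B / (1 - q)" if F: "finite F" for F J
  proof -
    define X where "X r = (\<Sum>k\<in>F. q powi k * theta_weight q k * ((q ^ 4) ^ (r choose 2) * (q powi (4 - 4 * k)) ^ r) * g k)" for r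
    have X: "X r \<le> q ^ r * L (S r ^ 2)" for r
      unfolding X_def g_def L_def by (rule theta_tilt_bound[OF F S])
    have X0: "0 \<le> X r" for r
      unfolding X_def using q g by (intro sum_nonneg mult_nonneg_nonneg) (auto simp: theta_weight_def)
    have "qpochhammer (- (q powi (4 - 4 * k))) (q ^ 4) J
        = (\<Sum>r\<le>J. qbinomial (q ^ 4) J r * (q ^ 4) ^ (r choose 2) * (q powi (4 - 4 * k)) ^ r)" for k
      unfolding q_binomial_theorem[symmetric] by (simp add: qpochhammer_def)
    then have "(\<Sum>k\<in>F. q powi k * theta_weight q k * qpochhammer (- (q powi (4 - 4 * k))) (q ^ 4) J * g k)
        = (\<Sum>k\<in>F. \<Sum>r\<le>J. qbinomial (q ^ 4) J r * (q powi k * theta_weight q k *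
              ((q ^ 4) ^ (r choose 2) * (q powi (4 - 4 * k)) ^ r) * g k))"
      by (simp add: sum_distrib_left sum_distrib_right mult_ac)
    also have "\<dots> = (\<Sum>r\<le>J. qbinomial (q ^ 4) J r * X r)"
      unfolding X_def sum_distrib_left by (rule sum.swap)
    also have "\<dots> = X 0 + (\<Sum>r=1..J. qbinomial (q ^ 4) J r * X r)"
      unfolding atMost_atLeast0 by (subst sum.atLeast_Suc_atMost) auto
    also have "\<dots> \<le> L (T ^ 2) + (\<Sum>r=1..J. K * (q ^ r * B))"
    proof (intro add_mono sum_mono)
      show "X 0 \<le> L (T ^ 2)" using X[of 0] assms(2) by simp
      fix r assume "r \<in> {1..J}"
      then have "X r \<le> q ^ r * B"
        using q
        by (intro order_trans[OF X[of r, unfolded L_def] mult_left_mono[OF B[of r]]]) auto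
      then show "qbinomial (q ^ 4) J r * X r \<le> K * (q ^ r * B)"
        using K X0[of r] q by (intro mult_mono) (auto intro: less_imp_le)
    qed
    also have "(\<Sum>r=1..J. K * (q ^ r * B)) = K * B * (\<Sum>r=1..J. q ^ r)"
      by (simp add: sum_distrib_left mult_ac)
    also have "(\<Sum>r=1..J. q ^ r) \<le> (\<Sum>r. q ^ r)"
      using q by (intro sum_le_suminf) (auto simp: summable_geometric)
    also have "(\<Sum>r. q ^ r) = 1 / (1 - q)" using q by (simp add: suminf_geometric)
    finally show ?thesis using K(1) B0 by (simp add: mult_left_mono)
  qed
  have "lattice_sum q (\<lambda>k. weight q (q powi k)) (T ^ 2) \<le> C * (L (T ^ 2) + K * B / (1 - q))"
    unfolding lattice_sum_def
  proof (rule infsum_le_finite_sums[OF lattice_summable[OF lw]])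
    fix F :: "int set" assume F: "finite F"
    \<comment> \<open>With \<open>F\<close> fixed, the partial products converge termwise.\<close>
    have "(\<Sum>k\<in>F. q powi k * weight q (q powi k) * (poly (T\<^sup>2) (q powi k) + poly (T\<^sup>2) (- (q powi k))))
        = C * (\<Sum>k\<in>F. q powi k * theta_weight q k * qpochhammer_inf (- (q powi (4 - 4 * k))) (q ^ 4) * g k)"
      by (simp add: C(2) g_def sum_distrib_left mult_ac)
    also have "\<dots> \<le> C * (L (T ^ 2) + K * B / (1 - q))"
    proof (intro mult_left_mono LIMSEQ_le_const2)
      show "(\<lambda>J. \<Sum>k\<in>F. q powi k * theta_weight q k * qpochhammer (- (q powi (4 - 4 * k))) (q ^ 4) J * g k)
         \<longlonglongrightarrow> (\<Sum>k\<in>F. q powi k * theta_weight q k * qpochhammer_inf (- (q powi (4 - 4 * k))) (q ^ 4) * g k)"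
        by (intro tendsto_intros qpochhammer_tendsto b)
    qed (use partial F C in auto)
    finally show "(\<Sum>k\<in>F. q powi k * weight q (q powi k) * (poly (T\<^sup>2) (q powi k) + poly (T\<^sup>2) (- (q powi k))))
        \<le> C * (L (T ^ 2) + K * B / (1 - q))" .
  qed
  then show ?thesis by (simp add: L_def K_def)
qed

end

end

section \<open>Asymptotics of the norms\<close>

lemma real_choose_2: "real (m choose 2) * 2 = real m * (real m - 1)"
  by (induction m) (simp_all add: Suc_choose_2 algebra_simps binomial_eq_0)

text \<open>
  The power of \<open>q\<close> is \<open>q\<^sup>m\<close> times the square of the leading coefficient of \<open>sw_poly q 1 d m\<close>, and the constants
  \<open>A\<close> and \<open>K\<close> are the same for both values of \<open>d\<close>. That the lower bound is \<open>A\<close> itself, with no error term, is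
  used for the quotient of consecutive norms.
\<close>
lemma norm_asymptotics:
  assumes q: "0 < q" "q < 1" and fam: "monic_orthogonal_family q P \<gamma>"
  obtains A K where "0 < A" "0 \<le> K"
    "\<And>m d. d \<le> 1 \<Longrightarrow> A \<le> \<gamma> (2 * m + d) * q ^ (4 * (m choose 2) + 2 * d * m + m)"
    "\<And>m d. d \<le> 1 \<Longrightarrow> \<gamma> (2 * m + d) * q ^ (4 * (m choose 2) + 2 * d * m + m) \<le> A + K * q ^ m"
proof -
  obtain C where C: "0 < C" "\<And>k. weight q (q powi k) =
      C * theta_weight q k * qpochhammer_inf (- (q powi (4 - 4 * k))) (q ^ 4)"
    by (rule weight_factorization[OF q]) blast
  note lt = lattice_weight_theta[OF q] and lw = lattice_weight_weight[OF q]
  define w where "w = (\<lambda>k. weight q (q powi k))"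
  define c where "c = 2 * theta_const q"
  have c: "0 < c" using theta_const_pos[OF q] by (simp add: c_def)
  define a where "a = qpochhammer_inf q q"
  note a = qpochhammer_inf_rate[OF q, folded a_def]
  define B where "B = c * qpochhammer_inf (- 1) q"
  have B0: "0 \<le> B" using qpochhammer_inf_mono_neg(1)[OF q, of 1 1] c by (simp add: B_def)
  define B' where "B' = B / (qpochhammer_inf (q ^ 4) (q ^ 4) * (1 - q))"
  have b: "0 < q ^ 4" "q ^ 4 < 1" using q by (simp_all add: power_less_one_iff)
  have B'0: "0 \<le> B'"
    using B0 qpochhammer_inf_rate(1)[OF b] q by (simp add: B'_def)
  define A where "A = C * c * a"
  define K where "K = C * (c / (1 - q) + B')"
  have "A \<le> \<gamma> (2 * m + d) * q ^ (4 * (m choose 2) + 2 * d * m + m) \<and>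
        \<gamma> (2 * m + d) * q ^ (4 * (m choose 2) + 2 * d * m + m) \<le> A + K * q ^ m" if d: "d \<le> 1" for m d
  proof -
    define n where "n = 2 * m + d"
    define l where "l = (-1) ^ m * q ^ (2 * (m choose 2) + d * m)"
    define T where "T = sw_poly q 1 d m"
    define R where "R = smult l (P n)"
    have deg: "degree (P k) = k \<and> lead_coeff (P k) = 1" for k
      using fam unfolding monic_orthogonal_family_def by blast
    have orth: "lattice_sum q w (P k * P j) = (if k = j then \<gamma> k else 0)" for k j
      using fam jackson_integral_eq_lattice_sum[of q "P k * P j"]
      unfolding monic_orthogonal_family_def w_def by (simp add: mult.assoc)
    have orthP: "orthogonal_below q w (P n) n"
      using orth unfolding w_def by (intro orthogonal_below_family[OF lw deg]) auto
    have l2: "l ^ 2 = q ^ (4 * (m choose 2) + 2 * d * m)"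
    proof -
      have "l ^ 2 = (q ^ (2 * (m choose 2) + d * m)) ^ 2"
        by (simp add: l_def power_mult_distrib flip: power_mult)
      also have "\<dots> = q ^ (4 * (m choose 2) + 2 * d * m)"
        by (simp only: power_mult [symmetric]) (simp add: algebra_simps)
      finally show ?thesis .
    qed
    have LR: "lattice_sum q w (R ^ 2) = l ^ 2 * \<gamma> n"
      unfolding R_def using orth[of n n] lattice_sum_smult[OF lw, folded w_def]
      by (simp add: power2_eq_square smult_smult)
    \<comment> \<open>\<open>R\<close> is \<open>P n\<close> rescaled to the leading coefficient of \<open>T\<close>, so each of the two can be the competitor of the other.\<close>
    have same: "coeff R i = coeff T i" if "i \<ge> n" for i
    proof (cases "i = n")
      case True
      then show ?thesis
        using deg[of n] coeff_sw_poly(1)[of q 1 d m] by (auto simp: R_def T_def l_def n_def)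
    next
      case False
      then show ?thesis
        using deg[of n] that coeff_sw_poly(2)[of m d i q 1] by (simp add: R_def T_def n_def coeff_eq_0)
    qed
    have LT: "lattice_sum q (theta_weight q) (T ^ 2) = c * qpochhammer q q m / q ^ m"
      unfolding T_def c_def by (rule sw_poly_norm[OF q d])
    have "C * (c * qpochhammer q q m / q ^ m) \<le> C * lattice_sum q (theta_weight q) (R ^ 2)"
      unfolding LT[symmetric] using C(1)
      by (intro mult_left_mono orthogonal_below_minimal[OF lt, of T n] same)
        (use sw_poly_orthogonal[OF q d] in \<open>auto simp: T_def n_def\<close>)
    also have "\<dots> \<le> l ^ 2 * \<gamma> n"
      unfolding LR[symmetric] w_def by (rule weight_sum_lower[OF q C])
    finally have lower: "C * (c * qpochhammer q q m / q ^ m) \<le> l ^ 2 * \<gamma> n" .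
    have "l ^ 2 * \<gamma> n \<le> lattice_sum q w (T ^ 2)"
      unfolding LR[symmetric] w_def
      by (rule orthogonal_below_minimal[OF lw, of _ n])
        (use orthogonal_below_smult[OF lw] orthP same in \<open>auto simp: R_def w_def\<close>)
    also have "\<dots> \<le> C * (lattice_sum q (theta_weight q) (T ^ 2) + B')"
      unfolding w_def B'_def
    proof (rule weight_sum_upper[OF q C, where S = "\<lambda>r. sw_poly q (q ^ (2 * r)) d m"])
      fix r and x :: real
      have "(poly T (q ^ r * x))\<^sup>2 = ((q ^ r) ^ d)\<^sup>2 * (poly (sw_poly q (q ^ (2 * r)) d m) x)\<^sup>2"
        unfolding T_def poly_sw_poly_scale by (simp add: power_mult_distrib mult.commute flip: power_mult)
      also have "\<dots> \<le> 1 * (poly (sw_poly q (q ^ (2 * r)) d m) x)\<^sup>2"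
        using q by (intro mult_right_mono power_le_one) auto
      finally show "(poly T (q ^ r * x))\<^sup>2 \<le> (poly (sw_poly q (q ^ (2 * r)) d m) x)\<^sup>2" by simp
    qed (use sw_poly_scaled_norm[OF q d] in \<open>auto simp: T_def B_def c_def\<close>)
    finally have upper: "l ^ 2 * \<gamma> n \<le> C * (c * qpochhammer q q m / q ^ m + B')"
      unfolding LT .
    have G: "\<gamma> (2 * m + d) * q ^ (4 * (m choose 2) + 2 * d * m + m) = l ^ 2 * \<gamma> n * q ^ m"
      unfolding l2 n_def by (simp add: power_add)
    have qm: "0 < q ^ m" using q by simp
    have "A \<le> C * (c * qpochhammer q q m)"
      using a(2)[of m] C(1) c by (simp add: A_def)
    also have "\<dots> = C * (c * qpochhammer q q m / q ^ m) * q ^ m"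
      using q by simp
    also have "\<dots> \<le> l ^ 2 * \<gamma> n * q ^ m" using lower qm by (intro mult_right_mono) auto
    finally have 1: "A \<le> l ^ 2 * \<gamma> n * q ^ m" .
    have "l ^ 2 * \<gamma> n * q ^ m \<le> C * (c * qpochhammer q q m / q ^ m + B') * q ^ m"
      using upper qm by (intro mult_right_mono) auto
    also have "\<dots> = C * (c * qpochhammer q q m + B' * q ^ m)"
      using q by (simp add: field_simps)
    also have "\<dots> \<le> C * (c * (a + q ^ m / (1 - q)) + B' * q ^ m)"
    proof -
      have "q ^ Suc m / (1 - q) \<le> q ^ m / (1 - q)"
        using q by (intro divide_right_mono) (auto simp: mult_left_le_one_le)
      then have "qpochhammer q q m \<le> a + q ^ m / (1 - q)" using a(3)[of m] by linarith
      then show ?thesis using C(1) c by (intro mult_left_mono add_right_mono) auto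
    qed
    also have "\<dots> = A + K * q ^ m" by (simp add: A_def K_def algebra_simps add_divide_distrib)
    finally show ?thesis using 1 unfolding G by simp
  qed
  moreover have "0 < A" using C(1) c a(1) by (simp add: A_def)
  moreover have "0 \<le> K" using C(1) c B'0 q by (simp add: K_def)
  ultimately show ?thesis using that by blast
qed

theorem theorem1p6:
  fixes q :: real and P :: "nat \<Rightarrow> real poly" and \<gamma> \<alpha> :: "nat \<Rightarrow> real"
  assumes "0 < q" and "q < 1"
    and "monic_orthogonal_family q P \<gamma>"
    and "\<And>n. n \<ge> 1 \<Longrightarrow> \<alpha> n = \<gamma> n / \<gamma> (n - 1)"
  shows "\<exists>A B :: real. B \<noteq> 0 \<and>
    (\<exists>e1 e2 e3 :: nat \<Rightarrow> real.
       e1 \<in> O[at_top_even](\<lambda>n. q powr (real n / 2)) \<and>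
       e2 \<in> O[at_top_even](\<lambda>n. q powr (real n / 2)) \<and>
       e3 \<in> O[at_top_even](\<lambda>n. q powr (real n / 2)) \<and>
       (\<forall>n \<ge> 2. even n \<longrightarrow>
          \<gamma> n = q powr (real n / 2 * (1 - real n)) * (A + e1 n) \<and>
          \<gamma> (n - 1) = q powr (real n / 2 * (3 - real n)) * (inverse B + e2 n) \<and>
          \<alpha> n = q powr (- real n) * (q + e3 n)))"
proof -
  note q = assms(1,2)
  obtain A K where A: "0 < A" "0 \<le> K"
    and lower: "\<And>m d. d \<le> 1 \<Longrightarrow> A \<le> \<gamma> (2 * m + d) * q ^ (4 * (m choose 2) + 2 * d * m + m)"
    and upper: "\<And>m d. d \<le> 1 \<Longrightarrow> \<gamma> (2 * m + d) * q ^ (4 * (m choose 2) + 2 * d * m + m) \<le> A + K * q ^ m"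
    using norm_asymptotics[OF assms(1-3)] by metis
  define e1 where "e1 n = \<gamma> n / q powr (real n / 2 * (1 - real n)) - A" for n
  define e2 where "e2 n = \<gamma> (n - 1) / q powr (real n / 2 * (3 - real n)) - A / q" for n
  define e3 where "e3 n = \<alpha> n / q powr (- real n) - q" for n
  have b1: "\<bar>e1 n\<bar> \<le> K * q powr (real n / 2)" if ev: "even n" for n
  proof -
    obtain m where m: "n = 2 * m" using ev by (rule evenE)
    have "q powr (real n / 2 * (1 - real n)) * q ^ (4 * (m choose 2) + m) = 1"
      unfolding powr_realpow[OF q(1), symmetric]
      using q real_choose_2[of m] by (simp add: m algebra_simps flip: powr_add)
    then have "\<gamma> n / q powr (real n / 2 * (1 - real n)) = \<gamma> n * q ^ (4 * (m choose 2) + m)"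
      by (simp only: divide_inverse inverse_unique)
    moreover have "q powr (real n / 2) = q ^ m"
      using q by (simp add: m powr_realpow)
    ultimately show ?thesis
      using lower[of 0 m] upper[of 0 m] A(2) q by (simp add: e1_def m abs_le_iff)
  qed
  have b2: "0 \<le> e2 n \<and> e2 n \<le> K / q ^ 2 * q powr (real n / 2)" if ev: "even n" "n \<ge> 2" for n
  proof -
    obtain k where "n = 2 * k" using ev(1) by (rule evenE)
    then obtain m where m: "n = 2 * m + 2" using ev(2) by (cases k) auto
    \<comment> \<open>The exponents differ by one: this is where \<open>inverse B = A / q\<close> comes from.\<close>
    have "q powr (real n / 2 * (3 - real n)) * q ^ (4 * (m choose 2) + 2 * 1 * m + m) = q powr 1"
      unfolding powr_realpow[OF q(1), symmetric] powr_add [symmetric]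
    proof (rule arg_cong[where f = "\<lambda>x. q powr x"])
      show "real n / 2 * (3 - real n) + real (4 * (m choose 2) + 2 * 1 * m + m) = 1"
        using real_choose_2[of m] by (simp add: m algebra_simps add_divide_distrib)
    qed
    then have "q powr (real n / 2 * (3 - real n)) * (q ^ (4 * (m choose 2) + 2 * 1 * m + m) / q) = 1"
      using q by simp
    note inv = inverse_unique[OF this]
    have nm: "n - 1 = 2 * m + 1" by (simp add: m)
    have "\<gamma> (n - 1) / q powr (real n / 2 * (3 - real n))
        = \<gamma> (2 * m + 1) * q ^ (4 * (m choose 2) + 2 * 1 * m + m) / q"
      unfolding nm divide_inverse[of "\<gamma> (2 * m + 1)"] inv by (simp only: times_divide_eq_right)
    then have e2: "e2 n = (\<gamma> (2 * m + 1) * q ^ (4 * (m choose 2) + 2 * 1 * m + m) - A) / q"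
      by (simp add: e2_def diff_divide_distrib)
    have "q powr (real n / 2) = q powr real (Suc m)" by (simp add: m add_divide_distrib)
    then have "q powr (real n / 2) = q * q ^ m" using q by (simp only: powr_realpow power_Suc)
    then have "K / q ^ 2 * q powr (real n / 2) = K * q ^ m / q"
      using q by (simp add: power2_eq_square)
    then show ?thesis unfolding e2
      using lower[of 1 m] upper[of 1 m] q by (auto intro!: divide_right_mono)
  qed
  have b3: "\<bar>e3 n\<bar> \<le> (K + q * (K / q ^ 2)) / (A / q) * q powr (real n / 2)" if n: "even n" "n \<ge> 2" for n
  proof -
    have "\<gamma> n = q powr (real n / 2 * (1 - real n)) * (A + e1 n)"
      "\<gamma> (n - 1) = q powr (real n / 2 * (3 - real n)) * (A / q + e2 n)"
      using q by (simp_all add: e1_def e2_def)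
    moreover have "q powr (real n / 2 * (1 - real n)) = q powr (- real n) * q powr (real n / 2 * (3 - real n))"
      unfolding powr_add [symmetric]
      by (rule arg_cong[where f = "\<lambda>x. q powr x"]) (simp add: field_simps)
    ultimately have "\<alpha> n = q powr (- real n) * ((A + e1 n) / (A / q + e2 n))"
      using assms(4)[of n] n q by simp
    then have "e3 n = (A + e1 n) / (A / q + e2 n) - q" using q by (simp add: e3_def)
    \<comment> \<open>The main terms cancel because \<open>q (A / q) = A\<close>; the denominator is at least \<open>A / q\<close> as \<open>e2 n \<ge> 0\<close>.\<close>
    also have "\<dots> = (e1 n - q * e2 n) / (A / q + e2 n)"
    proof -
      have "0 < A / q + e2 n" using b2[OF n] A(1) q by (intro add_pos_nonneg) auto
      moreover have "q * (A / q + e2 n) = A + q * e2 n" using q by (simp add: distrib_left)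
      moreover have "x / D - q = (x - q * D) / D" if "0 < D" for x D :: real
        using that by (simp add: diff_divide_distrib)
      ultimately show ?thesis by simp
    qed
    finally have "\<bar>e3 n\<bar> = \<bar>e1 n - q * e2 n\<bar> / \<bar>A / q + e2 n\<bar>" by (simp add: abs_divide)
    also have "\<dots> \<le> (K * q powr (real n / 2) + q * (K / q ^ 2 * q powr (real n / 2))) / (A / q)"
    proof (rule frac_le)
      have "\<bar>e1 n - q * e2 n\<bar> \<le> \<bar>e1 n\<bar> + q * \<bar>e2 n\<bar>"
        using abs_triangle_ineq4[of "e1 n" "q * e2 n"] q by (simp add: abs_mult)
      also have "\<dots> \<le> K * q powr (real n / 2) + q * (K / q ^ 2 * q powr (real n / 2))"
        using b1[OF n(1)] b2[OF n] q by (intro add_mono mult_left_mono) auto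
      finally show "\<bar>e1 n - q * e2 n\<bar> \<le> K * q powr (real n / 2) + q * (K / q ^ 2 * q powr (real n / 2))" .
    qed (use A q b2[OF n] in \<open>auto intro: add_nonneg_nonneg\<close>)
    also have "\<dots> = (K + q * (K / q ^ 2)) / (A / q) * q powr (real n / 2)"
      by (simp add: algebra_simps add_divide_distrib)
    finally show ?thesis .
  qed
  have ev: "eventually (\<lambda>n. even n \<and> n \<ge> 2) at_top_even"
    unfolding at_top_even_def eventually_inf_principal
    by (rule eventually_mono[OF eventually_ge_at_top[of "2 :: nat"]]) auto
  have "e1 \<in> O[at_top_even](\<lambda>n. q powr (real n / 2))"
    by (rule bigoI[where c = "K"], rule eventually_mono[OF ev]) (use b1 in auto)
  moreover have "e2 \<in> O[at_top_even](\<lambda>n. q powr (real n / 2))"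
    by (rule bigoI[where c = "K / q ^ 2"], rule eventually_mono[OF ev]) (use b2 in auto)
  moreover have "e3 \<in> O[at_top_even](\<lambda>n. q powr (real n / 2))"
    by (rule bigoI[where c = "(K + q * (K / q ^ 2)) / (A / q)"], rule eventually_mono[OF ev]) (use b3 in auto)
  moreover have "\<gamma> n = q powr (real n / 2 * (1 - real n)) * (A + e1 n) \<and>
      \<gamma> (n - 1) = q powr (real n / 2 * (3 - real n)) * (inverse (q / A) + e2 n) \<and>
      \<alpha> n = q powr (- real n) * (q + e3 n)" for n
    using q by (simp add: e1_def e2_def e3_def)
  moreover have "q / A \<noteq> 0" using A(1) q by simp
  ultimately have "q / A \<noteq> 0 \<and>
    (e1 \<in> O[at_top_even](\<lambda>n. q powr (real n / 2)) \<and>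
     e2 \<in> O[at_top_even](\<lambda>n. q powr (real n / 2)) \<and>
     e3 \<in> O[at_top_even](\<lambda>n. q powr (real n / 2)) \<and>
     (\<forall>n \<ge> 2. even n \<longrightarrow>
        \<gamma> n = q powr (real n / 2 * (1 - real n)) * (A + e1 n) \<and>
        \<gamma> (n - 1) = q powr (real n / 2 * (3 - real n)) * (inverse (q / A) + e2 n) \<and>
        \<alpha> n = q powr (- real n) * (q + e3 n)))"
    by blast
  then show ?thesis by blast
qed

end
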